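(* For any $\varepsilon>0$, any $\varepsilon$-band preserving linear map $T:X\to X$ on an order continuous Banach lattice $X$ is continuous.
   Context: A (not necessarily bounded) linear map $T:X\to X$ on a Banach lattice is $\varepsilon$-band preserving ($\varepsilon$-BP) if for every $x\in X$, $\sup\{\||Tx|\wedge y\| : y\ge 0,\ y\perp x\}\le\varepsilon\|x\|$. *)

theory Defs
  imports "HOL-Analysis.Analysis" "HOL-Library.Lattice_Algebras"
begin

class banach_lattice = banach + ordered_real_vector + lattice_ab_group_add_abs +
  assumes norm_mono_abs: "\<bar>x\<bar> \<le> \<bar>y\<bar> \<Longrightarrow> norm x \<le> norm y"

text \<open>
  The norm is order continuous if every net decreasing to \<open>0\<close> is norm null. A decreasing net
  is represented by its range \<open>D\<close>, a nonempty downward directed set indexed by itself; lemma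
  \<open>decreasing_net_norm_null\<close> below recovers nets over arbitrary directed index sets.
\<close>

class order_continuous_banach_lattice = banach_lattice +
  assumes order_continuous_norm:
    "D \<noteq> {} \<Longrightarrow>
     (\<And>a b. a \<in> D \<Longrightarrow> b \<in> D \<Longrightarrow> \<exists>c\<in>D. c \<le> a \<and> c \<le> b) \<Longrightarrow>
     (\<And>a. a \<in> D \<Longrightarrow> 0 \<le> a) \<Longrightarrow>
     (\<And>l. (\<And>a. a \<in> D \<Longrightarrow> l \<le> a) \<Longrightarrow> l \<le> 0) \<Longrightarrow>
     0 < e \<Longrightarrow> \<exists>a\<in>D. \<forall>b\<in>D. b \<le> a \<longrightarrow> norm b < e"

definition disjoint_elems :: "'a::banach_lattice \<Rightarrow> 'a \<Rightarrow> bool" where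
  "disjoint_elems x y \<longleftrightarrow> inf \<bar>x\<bar> \<bar>y\<bar> = 0"

definition band_preserving_upto :: "real \<Rightarrow> ('a::banach_lattice \<Rightarrow> 'a) \<Rightarrow> bool" where
  "band_preserving_upto \<epsilon> T \<longleftrightarrow>
     (\<forall>x. (SUP y\<in>{y. 0 \<le> y \<and> disjoint_elems y x}. norm (inf \<bar>T x\<bar> y)) \<le> \<epsilon> * norm x)"

lemma bdd_above_norm_inf_abs:
  fixes z :: "'a::banach_lattice"
  shows "bdd_above ((\<lambda>y. norm (inf \<bar>z\<bar> y)) ` {y. 0 \<le> y \<and> disjoint_elems y x})"
  by (rule bdd_aboveI2[where M = "norm z"]) (auto intro!: norm_mono_abs)

lemma band_preserving_upto_iff:
  "band_preserving_upto \<epsilon> T \<longleftrightarrow>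
     (\<forall>x y. 0 \<le> y \<longrightarrow> disjoint_elems y x \<longrightarrow> norm (inf \<bar>T x\<bar> y) \<le> \<epsilon> * norm x)"
proof -
  have "0 \<in> {y. 0 \<le> y \<and> disjoint_elems y x}" for x :: 'a
    by (simp add: disjoint_elems_def inf_absorb1)
  then have "{y. 0 \<le> y \<and> disjoint_elems y x} \<noteq> {}" for x :: 'a
    by blast
  from cSUP_le_iff[OF this bdd_above_norm_inf_abs] show ?thesis
    unfolding band_preserving_upto_def by blast
qed

lemma decreasing_net_norm_null:
  fixes u :: "'i \<Rightarrow> 'a::order_continuous_banach_lattice"
  assumes "I \<noteq> {}"
    and directed: "\<And>i j. i \<in> I \<Longrightarrow> j \<in> I \<Longrightarrow> \<exists>k\<in>I. le i k \<and> le j k"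
    and decreasing: "\<And>i j. i \<in> I \<Longrightarrow> j \<in> I \<Longrightarrow> le i j \<Longrightarrow> u j \<le> u i"
    and "\<And>i. i \<in> I \<Longrightarrow> 0 \<le> u i"
    and "\<And>l. (\<And>i. i \<in> I \<Longrightarrow> l \<le> u i) \<Longrightarrow> l \<le> 0"
    and "0 < e"
  shows "\<exists>i\<in>I. \<forall>j\<in>I. le i j \<longrightarrow> norm (u j) < e"
proof -
  have "\<exists>a\<in>u ` I. \<forall>b\<in>u ` I. b \<le> a \<longrightarrow> norm b < e"
  proof (rule order_continuous_norm)
    fix a b assume "a \<in> u ` I" "b \<in> u ` I"
    then show "\<exists>c\<in>u ` I. c \<le> a \<and> c \<le> b"
      using directed decreasing by (metis (no_types, lifting) imageE imageI)
  qed (use assms in auto)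
  then show ?thesis using decreasing by blast
qed

instance real :: lattice_ab_group_add_abs
  by standard (auto simp: sup_real_def abs_if max_def)

instance real :: order_continuous_banach_lattice
proof
  fix D :: "real set" and e :: real
  assume nonneg: "\<And>a. a \<in> D \<Longrightarrow> 0 \<le> a"
    and inf: "\<And>l. (\<And>a. a \<in> D \<Longrightarrow> l \<le> a) \<Longrightarrow> l \<le> 0" and "0 < e"
  from inf[of e] \<open>0 < e\<close> obtain a where "a \<in> D" "a < e"
    by force
  with nonneg show "\<exists>a\<in>D. \<forall>b\<in>D. b \<le> a \<longrightarrow> norm b < e"
    by force
qed auto

end

theory Submission
  imports Defs
begin

text \<open>
  For a band projection \<open>P\<close> the off-diagonal block \<open>P T (1 - P)\<close> has norm at most \<open>\<epsilon>\<close>; call \<open>P\<close> good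
  if the diagonal block \<open>P T P\<close> is bounded. A gliding hump argument shows that a disjoint sequence
  of projections cannot have arbitrarily large diagonal blocks. Hence the diagonal blocks of good
  projections are uniformly bounded. A positive \<open>w \<noteq> 0\<close> annihilated by all good projections would
  either be an atom, whose rank-one band projection is good, or split indefinitely into disjoint
  pieces with unbounded diagonal blocks; both are impossible. So, by order continuity of the norm,
  good projections approximate the identity pointwise, and the uniform bound passes to \<open>T\<close>.
\<close>

section \<open>Banach lattices\<close>

lemma norm_mono_nonneg:
  fixes x :: "'a::banach_lattice"
  assumes "0 \<le> x" "x \<le> y"
  shows "norm x \<le> norm y"
  using assms by (intro norm_mono_abs) (simp add: order_trans)

lemma pprt_diff_pprt_neg:
  fixes x :: "'a::lattice_ab_group_add"
  shows "pprt x - pprt (- x) = x"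
  using prts[of x] by (simp add: pprt_neg)

lemma inf_pprt_pprt_neg:
  fixes x :: "'a::lattice_ab_group_add"
  shows "inf (pprt x) (pprt (- x)) = 0"
proof -
  have "inf (pprt x) (pprt (- x)) = inf (x + pprt (- x)) (0 + pprt (- x))"
    using pprt_diff_pprt_neg[of x] by (simp add: algebra_simps)
  also have "\<dots> = inf x 0 + pprt (- x)"
    by (simp only: add_inf_distrib_right)
  also have "\<dots> = 0"
    using neg_inf_eq_sup[of x 0] by (simp add: pprt_def add_eq_0_iff)
  finally show ?thesis .
qed

lemma pprt_le_abs:
  fixes x :: "'a::banach_lattice"
  shows "pprt x \<le> \<bar>x\<bar>"
  by (simp add: pprt_def abs_ge_self)

text \<open>Closedness of the positive cone: \<open>0 \<le> f i\<close> puts \<open>- l\<close>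
  below \<open>f i - l\<close>, so \<open>pprt (- l)\<close> is dominated in norm by
  \<open>f i - l\<close>, which tends to \<open>0\<close>.\<close>

lemma tendsto_nonneg:
  fixes f :: "'i \<Rightarrow> 'a::banach_lattice"
  assumes lim: "(f \<longlongrightarrow> l) F" and "F \<noteq> bot" and ev: "eventually (\<lambda>i. 0 \<le> f i) F"
  shows "0 \<le> l"
proof -
  have "norm (pprt (- l)) \<le> 0"
  proof (rule tendsto_lowerbound[OF _ _ \<open>F \<noteq> bot\<close>])
    show "((\<lambda>i. norm (f i - l)) \<longlongrightarrow> 0) F"
      using lim by (simp add: LIM_zero tendsto_norm_zero)
    show "eventually (\<lambda>i. norm (pprt (- l)) \<le> norm (f i - l)) F"
      using ev
    proof eventually_elim
      case (elim i)
      then have "pprt (- l) \<le> pprt (f i - l)"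
        by (intro pprt_mono) simp
      also have "\<dots> \<le> \<bar>f i - l\<bar>"
        by (rule pprt_le_abs)
      finally show ?case
        by (intro norm_mono_abs) simp
    qed
  qed
  then show ?thesis
    using le_zero_iff_zero_pprt[of "- l"] by simp
qed

lemma tendsto_le_lattice:
  fixes f g :: "'i \<Rightarrow> 'a::banach_lattice"
  assumes "(f \<longlongrightarrow> l) F" "(g \<longlongrightarrow> m) F" "F \<noteq> bot" "eventually (\<lambda>i. f i \<le> g i) F"
  shows "l \<le> m"
proof -
  have "0 \<le> m - l"
    using tendsto_nonneg[OF tendsto_diff[OF assms(2,1)] assms(3)] assms(4) by simp
  then show ?thesis by simp
qed

text \<open>Dividing by \<open>n\<close> puts \<open>l\<close> below a null sequence, and the
  positive cone is closed.\<close>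

lemma archimedean_le_zero:
  fixes l u :: "'a::banach_lattice"
  assumes "\<And>n::nat. real n *\<^sub>R l \<le> u"
  shows "l \<le> 0"
proof -
  have "(\<lambda>n. inverse (real (Suc n)) *\<^sub>R u) \<longlonglongrightarrow> 0 *\<^sub>R u"
    by (intro tendsto_scaleR LIMSEQ_inverse_real_of_nat tendsto_const)
  moreover have "l \<le> inverse (real (Suc n)) *\<^sub>R u" for n
    using scaleR_left_mono[OF assms[of "Suc n"], of "inverse (real (Suc n))"]
    by (simp del: of_nat_Suc)
  ultimately show ?thesis
    using tendsto_le_lattice[of "\<lambda>_. l" l sequentially] by simp
qed

lemma scaleR_inf_distrib:
  fixes x y :: "'a::banach_lattice"
  assumes "0 < c"
  shows "c *\<^sub>R inf x y = inf (c *\<^sub>R x) (c *\<^sub>R y)"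
proof (rule antisym)
  show "c *\<^sub>R inf x y \<le> inf (c *\<^sub>R x) (c *\<^sub>R y)"
    using assms by (auto intro!: scaleR_left_mono)
  have "inverse c *\<^sub>R inf (c *\<^sub>R x) (c *\<^sub>R y) \<le> inf x y"
    using scaleR_left_mono[OF inf_le1, of "inverse c" "c *\<^sub>R x" "c *\<^sub>R y"]
      scaleR_left_mono[OF inf_le2, of "inverse c" "c *\<^sub>R x" "c *\<^sub>R y"] assms
    by auto
  from scaleR_left_mono[OF this, of c] assms
  show "inf (c *\<^sub>R x) (c *\<^sub>R y) \<le> c *\<^sub>R inf x y"
    by simp
qed

text \<open>
  Dedekind completeness: the differences of upper bounds and elements of \<open>D\<close> decrease to \<open>0\<close>, so
  order continuity makes upper bounds and elements of \<open>D\<close> Cauchy with a common norm limit.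
\<close>

lemma directed_bounded_norm_sup:
  fixes D :: "'a::order_continuous_banach_lattice set"
  assumes "D \<noteq> {}"
    and directed: "\<And>a b. a \<in> D \<Longrightarrow> b \<in> D \<Longrightarrow> \<exists>c\<in>D. a \<le> c \<and> b \<le> c"
    and bounded: "\<And>a. a \<in> D \<Longrightarrow> a \<le> u"
  obtains s where "\<And>a. a \<in> D \<Longrightarrow> a \<le> s"
    and "\<And>y. (\<And>a. a \<in> D \<Longrightarrow> a \<le> y) \<Longrightarrow> s \<le> y"
    and "\<And>e. 0 < e \<Longrightarrow> \<exists>a\<in>D. \<forall>b\<in>D. a \<le> b \<longrightarrow> norm (s - b) < e"
proof -
  define U where "U = {y. \<forall>a\<in>D. a \<le> y}"
  define E where "E = {y - a |y a. y \<in> U \<and> a \<in> D}"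
  have "u \<in> U"
    using bounded by (simp add: U_def)
  have small: "\<exists>x. fst x \<in> U \<and> snd x \<in> D \<and> norm (fst x - snd x) < e" if "0 < e" for e
  proof -
    have "\<exists>a\<in>E. \<forall>b\<in>E. b \<le> a \<longrightarrow> norm b < e"
    proof (rule order_continuous_norm)
      show "E \<noteq> {}"
        using \<open>u \<in> U\<close> \<open>D \<noteq> {}\<close> by (auto simp: E_def)
      show "\<exists>c\<in>E. c \<le> p \<and> c \<le> q" if pq: "p \<in> E" "q \<in> E" for p q
      proof -
        obtain y a z b where *: "p = y - a" "q = z - b" "y \<in> U" "z \<in> U" "a \<in> D" "b \<in> D"
          using pq by (auto simp: E_def)
        obtain c where c: "c \<in> D" "a \<le> c" "b \<le> c"
          using directed * by blast
        have "inf y z - c \<in> E"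
          using * c by (force simp: E_def U_def)
        moreover have "inf y z - c \<le> p" "inf y z - c \<le> q"
          using * c by (auto intro!: diff_mono)
        ultimately show ?thesis by blast
      qed
      show "0 \<le> a" if "a \<in> E" for a
        using that by (auto simp: E_def U_def)
      show "l \<le> 0" if l: "\<And>a. a \<in> E \<Longrightarrow> l \<le> a" for l
      proof -
        obtain a where "a \<in> D"
          using \<open>D \<noteq> {}\<close> by blast
        \<comment> \<open>A lower bound \<open>l\<close> of all gaps \<open>y - a\<close> can be
          subtracted from any upper bound of \<open>D\<close>. Iterating from \<open>u\<close>
          bounds every multiple of \<open>l\<close> by \<open>u - a\<close>, and the Archimedean
          property applies.\<close>
        have step: "y - l \<in> U" if "y \<in> U" for y
        proof -
          have "b \<le> y - l" if "b \<in> D" for b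
            using l[of "y - b"] that \<open>y \<in> U\<close> by (force simp: E_def algebra_simps)
          then show ?thesis by (simp add: U_def)
        qed
        have "u - real n *\<^sub>R l \<in> U" for n
        proof (induction n)
          case (Suc n)
          from step[OF this] show ?case
            by (simp add: scaleR_add_left diff_diff_eq add.commute)
        qed (simp add: \<open>u \<in> U\<close>)
        then have "real n *\<^sub>R l \<le> u - a" for n
          using \<open>a \<in> D\<close> by (force simp: U_def algebra_simps)
        then show ?thesis
          by (rule archimedean_le_zero)
      qed
    qed (use that in auto)
    then obtain y a where "y \<in> U" "a \<in> D" "norm (y - a) < e"
      by (force simp: E_def)
    then show ?thesis
      by (intro exI[of _ "(y, a)"]) simp
  qed
  then have "\<forall>n. \<exists>x. fst x \<in> U \<and> snd x \<in> D \<and> norm (fst x - snd x) < inverse (real (Suc n))"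
    by simp
  then obtain f where f: "\<And>n. fst (f n) \<in> U" "\<And>n. snd (f n) \<in> D"
    "\<And>n. norm (fst (f n) - snd (f n)) < inverse (real (Suc n))"
    by metis
  define y where "y n = fst (f n)" for n
  define a where "a n = snd (f n)" for n
  have y: "y n \<in> U" and a: "a n \<in> D" and ya: "norm (y n - a n) < inverse (real (Suc n))" for n
    using f by (simp_all add: y_def a_def)
  \<comment> \<open>Moving up in \<open>D\<close> only shrinks the gap to \<open>y n\<close>. Hence
    \<open>y m\<close> and \<open>y n\<close> are both close to any \<open>b\<close> above
    \<open>a m\<close> and \<open>a n\<close>, which makes \<open>y\<close> Cauchy.\<close>
  have yb: "norm (y n - b) < inverse (real (Suc n))" if "b \<in> D" "a n \<le> b" for n b
  proof -
    have "norm (y n - b) \<le> norm (y n - a n)"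
      using y[of n] that by (intro norm_mono_nonneg) (auto simp: U_def)
    then show ?thesis
      using ya[of n] by simp
  qed
  have "Cauchy y"
  proof (rule metric_CauchyI)
    fix e :: real assume "0 < e"
    then obtain N where N: "inverse (real (Suc N)) < e / 2"
      using reals_Archimedean[of "e / 2"] by auto
    have "dist (y m) (y n) < e" if "N \<le> m" "N \<le> n" for m n
    proof -
      obtain b where b: "b \<in> D" "a m \<le> b" "a n \<le> b"
        using directed a by blast
      have "inverse (real (Suc m)) \<le> inverse (real (Suc N))"
        "inverse (real (Suc n)) \<le> inverse (real (Suc N))"
        using that by (auto intro!: le_imp_inverse_le)
      then have "dist (y m) b < e / 2" "dist (y n) b < e / 2"
        using yb[OF b(1,2)] yb[OF b(1,3)] N unfolding dist_norm by linarith+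
      then show ?thesis
        by (rule dist_triangle_half_l)
    qed
    then show "\<exists>N. \<forall>m\<ge>N. \<forall>n\<ge>N. dist (y m) (y n) < e"
      by blast
  qed
  then obtain s where s: "y \<longlonglongrightarrow> s"
    using Cauchy_convergent_iff convergent_def by blast
  have ya_lim: "(\<lambda>n. y n - a n) \<longlonglongrightarrow> 0"
    by (rule Lim_null_comparison[OF _ LIMSEQ_inverse_real_of_nat])
      (use ya in \<open>auto intro!: always_eventually less_imp_le\<close>)
  have a_lim: "a \<longlonglongrightarrow> s"
    using tendsto_diff[OF s ya_lim] by simp
  show ?thesis
  proof
    show upper: "b \<le> s" if "b \<in> D" for b
      using tendsto_le_lattice[OF tendsto_const[of b] s] y that by (auto simp: U_def)
    show "s \<le> z" if "\<And>b. b \<in> D \<Longrightarrow> b \<le> z" for z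
      using tendsto_le_lattice[OF a_lim tendsto_const[of z]] a that by auto
    fix e :: real assume "0 < e"
    with a_lim obtain n where n: "norm (a n - s) < e"
      using LIMSEQ_D by blast
    have "norm (s - b) < e" if "b \<in> D" "a n \<le> b" for b
    proof -
      have "norm (s - b) \<le> norm (s - a n)"
        using that upper by (intro norm_mono_nonneg) auto
      with n show ?thesis by (simp add: norm_minus_commute)
    qed
    then show "\<exists>a\<in>D. \<forall>b\<in>D. a \<le> b \<longrightarrow> norm (s - b) < e"
      using a by blast
  qed
qed

section \<open>Band projections\<close>

text \<open>The order-theoretic characterisation of projections onto projection bands: linear
  idempotents between \<open>0\<close> and the identity. It avoids speaking of the bands
  themselves.\<close>

definition band_projection :: "('a::banach_lattice \<Rightarrow> 'a) \<Rightarrow> bool" where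
  "band_projection P \<longleftrightarrow>
     linear P \<and> (\<forall>x. P (P x) = P x) \<and> (\<forall>x\<ge>0. 0 \<le> P x \<and> P x \<le> x)"

lemma band_projection_linear: "band_projection P \<Longrightarrow> linear P"
  and band_projection_idem: "band_projection P \<Longrightarrow> P (P x) = P x"
  and band_projection_nonneg: "band_projection P \<Longrightarrow> 0 \<le> x \<Longrightarrow> 0 \<le> P x"
  and band_projection_le: "band_projection P \<Longrightarrow> 0 \<le> x \<Longrightarrow> P x \<le> x"
  by (simp_all add: band_projection_def)

lemmas band_projection_add = linear_add[OF band_projection_linear]
  and band_projection_diff = linear_diff[OF band_projection_linear]
  and band_projection_zero = linear_0[OF band_projection_linear]
  and band_projection_scale = linear_scale[OF band_projection_linear]
  and band_projection_neg = linear_neg[OF band_projection_linear]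

lemma band_projection_mono:
  assumes "band_projection P" "x \<le> y"
  shows "P x \<le> P y"
  using band_projection_nonneg[OF assms(1), of "y - x"] assms
  by (simp add: band_projection_diff)

lemma band_projection_abs_le:
  assumes "band_projection P"
  shows "\<bar>P x\<bar> \<le> P \<bar>x\<bar>"
proof -
  have "P x \<le> P \<bar>x\<bar>" "P (- x) \<le> P \<bar>x\<bar>"
    by (rule band_projection_mono[OF assms abs_ge_self] band_projection_mono[OF assms abs_ge_minus_self])+
  then show ?thesis
    using assms by (simp add: abs_le_iff band_projection_neg)
qed

lemma band_projection_norm_le:
  assumes "band_projection P"
  shows "norm (P x) \<le> norm x"
  using band_projection_abs_le[OF assms] band_projection_le[OF assms abs_ge_zero]
  by (intro norm_mono_abs) (rule order_trans)

lemma band_projection_bounded_linear: "band_projection P \<Longrightarrow> bounded_linear P"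
  by (rule bounded_linear_intro[where K = 1])
    (simp_all add: band_projection_add band_projection_scale band_projection_norm_le)

section \<open>The Boolean algebra of band projections\<close>

lemma band_projection_compl:
  assumes "band_projection P"
  shows "band_projection (\<lambda>x. x - P x)"
  using assms unfolding band_projection_def
  by (auto simp: linear_diff linear_compose_sub linear_id[unfolded id_def])

lemma linear_eq_on_cone:
  fixes f g :: "'a::banach_lattice \<Rightarrow> 'b::real_vector"
  assumes "linear f" "linear g" "\<And>x. 0 \<le> x \<Longrightarrow> f x = g x"
  shows "f x = g x"
  using linear_diff[OF assms(1), of "pprt x" "pprt (- x)"]
    linear_diff[OF assms(2), of "pprt x" "pprt (- x)"] assms(3)[of "pprt x"] assms(3)[of "pprt (- x)"]
  by (simp add: pprt_diff_pprt_neg)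

text \<open>On the cone \<open>Q (P x)\<close> lies between \<open>0\<close> and \<open>P x\<close>,
  and the complement of \<open>P\<close> is positive and kills \<open>P x\<close>, so it kills
  \<open>Q (P x)\<close> as well.\<close>

lemma band_projection_absorb:
  assumes P: "band_projection P" and Q: "band_projection Q"
  shows "P (Q (P x)) = Q (P x)"
proof (rule linear_eq_on_cone[of "\<lambda>x. P (Q (P x))" "\<lambda>x. Q (P x)"])
  show "linear (\<lambda>x. P (Q (P x)))" "linear (\<lambda>x. Q (P x))"
    using linear_compose[of P Q] linear_compose[of "Q \<circ> P" P] P Q
    by (simp_all add: band_projection_linear o_def)
  fix x :: 'a assume "0 \<le> x"
  note C = band_projection_compl[OF P]
  have "0 \<le> P x"
    using P \<open>0 \<le> x\<close> by (rule band_projection_nonneg)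
  moreover have "Q (P x) \<le> P x"
    using Q \<open>0 \<le> P x\<close> by (rule band_projection_le)
  ultimately have "0 \<le> Q (P x) - P (Q (P x))" "Q (P x) - P (Q (P x)) \<le> P x - P (P x)"
    using band_projection_nonneg[OF C] band_projection_mono[OF C] band_projection_nonneg[OF Q]
    by blast+
  then show "P (Q (P x)) = Q (P x)"
    using band_projection_idem[OF P] by simp
qed

text \<open>Absorption for \<open>P\<close> gives \<open>P Q P = Q P\<close>; absorption for the
  complement of \<open>P\<close> gives \<open>P Q (1 - P) = 0\<close>, that is
  \<open>P Q = P Q P\<close>.\<close>

lemma band_projection_commute:
  assumes P: "band_projection P" and Q: "band_projection Q"
  shows "P (Q x) = Q (P x)"
  using band_projection_absorb[OF P Q, of x] band_projection_absorb[OF band_projection_compl[OF P] Q, of x]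
    P Q by (simp add: band_projection_diff)

lemma band_projection_compose:
  assumes P: "band_projection P" and Q: "band_projection Q"
  shows "band_projection (\<lambda>x. P (Q x))"
  unfolding band_projection_def
proof (intro conjI allI impI)
  show "linear (\<lambda>x. P (Q x))"
    using linear_compose[of Q P] P Q by (simp add: band_projection_linear o_def)
  show "P (Q (P (Q x))) = P (Q x)" for x
    by (simp add: band_projection_absorb[OF P Q] band_projection_commute[OF Q P]
        band_projection_idem P Q)
  show "0 \<le> P (Q x)" if "0 \<le> x" for x
    using that P Q by (simp add: band_projection_nonneg)
  show "P (Q x) \<le> x" if "0 \<le> x" for x
    using band_projection_le[OF P band_projection_nonneg[OF Q that]] band_projection_le[OF Q that]
    by (rule order_trans)
qed

lemma band_projection_zero_fun: "band_projection (\<lambda>x. 0)"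
  by (simp add: band_projection_def linear_iff)

text \<open>By De Morgan, this is the complement of the product
  \<open>(1 - P) (1 - Q)\<close>.\<close>

lemma band_projection_join:
  assumes P: "band_projection P" and Q: "band_projection Q"
  shows "band_projection (\<lambda>x. P x + (Q x - P (Q x)))"
proof -
  note C = band_projection_compl[OF band_projection_compose[OF band_projection_compl[OF P]
        band_projection_compl[OF Q]]]
  have "(\<lambda>x. x - ((x - Q x) - P (x - Q x))) = (\<lambda>x. P x + (Q x - P (Q x)))"
    using P by (simp add: fun_eq_iff band_projection_diff)
  with C show ?thesis by simp
qed

text \<open>The infimum \<open>v\<close> lies below an element killed by \<open>P\<close> and below
  one killed by \<open>1 - P\<close>; so \<open>P v\<close> and \<open>v - P v\<close>, whose sum is
  \<open>v\<close>, are both at most \<open>0\<close>.\<close>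

lemma band_projection_disjoint_compl:
  assumes P: "band_projection P" and "0 \<le> y"
  shows "inf \<bar>y - P y\<bar> \<bar>P x\<bar> = 0"
proof -
  define v where "v = inf (y - P y) \<bar>P x\<bar>"
  note C = band_projection_compl[OF P]
  have y: "0 \<le> y - P y"
    using band_projection_nonneg[OF C \<open>0 \<le> y\<close>] .
  then have "0 \<le> v"
    by (simp add: v_def)
  have "P v \<le> P (y - P y)"
    by (rule band_projection_mono[OF P]) (simp add: v_def)
  then have "P v \<le> 0"
    using P by (simp add: band_projection_diff band_projection_idem)
  moreover have "v \<le> P \<bar>x\<bar>"
    using band_projection_abs_le[OF P, of x] unfolding v_def by (rule le_infI2)
  then have "v - P v \<le> 0"
    using band_projection_mono[OF C, of v "P \<bar>x\<bar>"] P by (simp add: band_projection_idem)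
  ultimately have "v \<le> 0"
    using add_mono[of "P v" 0 "v - P v" 0] by simp
  with \<open>0 \<le> v\<close> have "v = 0"
    by simp
  then show ?thesis
    using y by (simp add: v_def)
qed

text \<open>Since \<open>1 - P\<close> kills \<open>v\<close>, it sends the positive and the
  negative part of \<open>v\<close> to the same element \<open>r\<close>. Then \<open>r\<close> lies
  below both parts, which are disjoint.\<close>

lemma band_projection_pprt_fixed:
  assumes P: "band_projection P" and v: "P v = v"
  shows "P (pprt v) = pprt v"
proof -
  define r where "r = pprt v - P (pprt v)"
  have "P (pprt v) - P (pprt (- v)) = pprt v - pprt (- v)"
    using v P by (simp flip: band_projection_diff add: pprt_diff_pprt_neg)
  then have r: "r = pprt (- v) - P (pprt (- v))"
    by (simp add: r_def algebra_simps)
  have "r \<le> inf (pprt v) (pprt (- v))"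
    using band_projection_nonneg[OF P zero_le_pprt, of v]
      band_projection_nonneg[OF P zero_le_pprt, of "- v"]
    by (subst le_inf_iff) (simp add: r_def, simp add: r flip: r_def)
  then have "r \<le> 0"
    by (simp add: inf_pprt_pprt_neg)
  moreover have "0 \<le> r"
    using band_projection_le[OF P zero_le_pprt] by (simp add: r_def)
  ultimately show ?thesis
    by (simp add: r_def)
qed

section \<open>Projections onto principal bands\<close>

text \<open>
  The projection onto the band generated by \<open>e\<close> is \<open>x \<mapsto> lim (inf x (t e))\<close> as \<open>t \<rightarrow> \<infinity>\<close> on the
  positive cone.
\<close>

lemma principal_limit:
  fixes e x :: "'a::order_continuous_banach_lattice"
  assumes "0 \<le> e"
  shows "\<exists>s. ((\<lambda>t::real. inf x (t *\<^sub>R e)) \<longlongrightarrow> s) at_top"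
proof -
  define D where "D = range (\<lambda>t::real. inf x (t *\<^sub>R e))"
  have mono: "inf x (t *\<^sub>R e) \<le> inf x (t' *\<^sub>R e)" if "t \<le> t'" for t t'
    using that assms by (intro inf_mono scaleR_right_mono) auto
  obtain s where s: "\<And>e. 0 < e \<Longrightarrow> \<exists>a\<in>D. \<forall>b\<in>D. a \<le> b \<longrightarrow> norm (s - b) < e"
  proof (rule directed_bounded_norm_sup[of D x])
    show "\<exists>c\<in>D. a \<le> c \<and> b \<le> c" if ab: "a \<in> D" "b \<in> D" for a b
    proof -
      obtain t t' where "a = inf x (t *\<^sub>R e)" "b = inf x (t' *\<^sub>R e)"
        using ab unfolding D_def by blast
      then show ?thesis
        using mono[of t "max t t'"] mono[of t' "max t t'"]
        by (intro bexI[of _ "inf x (max t t' *\<^sub>R e)"]) (auto simp: D_def)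
    qed
  qed (auto simp: D_def)
  have "((\<lambda>t::real. inf x (t *\<^sub>R e)) \<longlongrightarrow> s) at_top"
  proof (rule tendstoI)
    fix \<delta> :: real assume "0 < \<delta>"
    then obtain t where "\<forall>b\<in>D. inf x (t *\<^sub>R e) \<le> b \<longrightarrow> norm (s - b) < \<delta>"
      using s by (force simp: D_def)
    then have "\<forall>t'\<ge>t. dist (inf x (t' *\<^sub>R e)) s < \<delta>"
      using mono by (auto simp: D_def dist_norm norm_minus_commute)
    then show "\<forall>\<^sub>F t in at_top. dist (inf x (t *\<^sub>R e)) s < \<delta>"
      using eventually_at_top_linorder by blast
  qed
  then show ?thesis ..
qed

text \<open>Kantorovich extension: every element is a difference of positive ones, and additivity
  makes the value independent of the chosen difference.\<close>

lemma linear_extension_from_cone: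
  fixes p :: "'a::banach_lattice \<Rightarrow> 'a"
  assumes add: "\<And>x y. 0 \<le> x \<Longrightarrow> 0 \<le> y \<Longrightarrow> p (x + y) = p x + p y"
    and scale: "\<And>c x. 0 < c \<Longrightarrow> 0 \<le> x \<Longrightarrow> p (c *\<^sub>R x) = c *\<^sub>R p x"
  obtains P where "linear P" "\<And>x. 0 \<le> x \<Longrightarrow> P x = p x"
proof -
  define P where "P x = p (pprt x) - p (pprt (- x))" for x
  have p0: "p 0 = 0"
    using add[of 0 0] by simp
  have diff: "P (a - b) = p a - p b" if "0 \<le> a" "0 \<le> b" for a b
  proof -
    have "pprt (a - b) + b = a + pprt (- (a - b))"
      using pprt_diff_pprt_neg[of "a - b"] by (simp add: algebra_simps)
    then have "p (pprt (a - b)) + p b = p a + p (pprt (- (a - b)))"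
      using that by (metis add zero_le_pprt)
    then show ?thesis
      by (simp add: P_def algebra_simps)
  qed
  have P_add: "P (x + y) = P x + P y" for x y
  proof -
    have "x + y = (pprt x + pprt y) - (pprt (- x) + pprt (- y))"
      using pprt_diff_pprt_neg[of x] pprt_diff_pprt_neg[of y] by (simp add: algebra_simps)
    then have "P (x + y) = p (pprt x + pprt y) - p (pprt (- x) + pprt (- y))"
      using diff by (metis add_nonneg_nonneg zero_le_pprt)
    then show ?thesis
      by (simp add: P_def add)
  qed
  have P_neg: "P (- x) = - P x" for x
    by (simp add: P_def)
  have P_pos: "P (c *\<^sub>R x) = c *\<^sub>R P x" if "0 < c" for c x
  proof -
    have "c *\<^sub>R x = c *\<^sub>R pprt x - c *\<^sub>R pprt (- x)"
      by (simp flip: scaleR_diff_right add: pprt_diff_pprt_neg)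
    then have "P (c *\<^sub>R x) = p (c *\<^sub>R pprt x) - p (c *\<^sub>R pprt (- x))"
      using that diff by (metis less_imp_le scaleR_nonneg_nonneg zero_le_pprt)
    then show ?thesis
      using that by (simp add: P_def scale scaleR_diff_right)
  qed
  have "P (c *\<^sub>R x) = c *\<^sub>R P x" for c x
  proof (cases c "0::real" rule: linorder_cases)
    case less
    then show ?thesis
      using P_pos[of "- c" x] P_neg[of "c *\<^sub>R x"] by simp
  next
    case equal
    then show ?thesis by (simp add: P_def p0)
  qed (rule P_pos)
  then have "linear P"
    using P_add by (intro linearI)
  moreover have "P x = p x" if "0 \<le> x" for x
    using diff[OF that order_refl] p0 by simp
  ultimately show ?thesis
    using that by blast
qed

text \<open>The third and fourth properties work together: the projection of one element kills any
  element disjoint from it, hence the whole band of that element. Disjoint elements thus give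
  mutually annihilating projections.\<close>

lemma principal_band_projection:
  fixes e :: "'a::order_continuous_banach_lattice"
  assumes "0 \<le> e"
  obtains P where "band_projection P" "P e = e"
    and "\<And>x. 0 \<le> x \<Longrightarrow> inf x e = 0 \<Longrightarrow> P x = 0"
    and "\<And>Q x. band_projection Q \<Longrightarrow> Q e = 0 \<Longrightarrow> Q (P x) = 0"
proof -
  define p where "p x = (SOME s. ((\<lambda>t::real. inf x (t *\<^sub>R e)) \<longlongrightarrow> s) at_top)" for x
  have p: "((\<lambda>t::real. inf x (t *\<^sub>R e)) \<longlongrightarrow> p x) at_top" for x
    unfolding p_def using principal_limit[OF assms] by (rule someI_ex)
  have p_eqI: "p x = s" if "((\<lambda>t::real. inf x (t *\<^sub>R e)) \<longlongrightarrow> s) at_top" for x s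
    using tendsto_unique[OF _ p that] by simp
  have te: "0 \<le> t *\<^sub>R e" if "0 \<le> t" for t
    using assms that by (rule scaleR_nonneg_nonneg[rotated])
  have p_nonneg: "0 \<le> p x" if "0 \<le> x" for x
    by (rule tendsto_nonneg[OF p], simp, rule eventually_mono[OF eventually_ge_at_top[of 0]])
      (use that te in auto)
  have p_le: "p x \<le> x" for x
    by (rule tendsto_le_lattice[OF p tendsto_const]) auto
  have mono: "inf x (t *\<^sub>R e) \<le> inf x (t' *\<^sub>R e)" if "t \<le> t'" for x t t'
    using that assms by (intro inf_mono scaleR_right_mono) auto
  have p_ge: "inf x (t *\<^sub>R e) \<le> p x" for x t
    by (rule tendsto_le_lattice[OF tendsto_const p], simp,
        rule eventually_mono[OF eventually_ge_at_top[of t]]) (rule mono)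
  have p_e: "p e = e"
    using p_ge[of e 1] p_le[of e] by simp
  have p_idem: "p (p x) = p x" for x
  proof (rule antisym[OF p_le])
    have "inf x (t *\<^sub>R e) \<le> p (p x)" for t
      using p_ge[of x t] p_ge[of "p x" t] by (meson inf_le2 le_inf_iff order_trans)
    then show "p x \<le> p (p x)"
      by (intro tendsto_le_lattice[OF p tendsto_const]) auto
  qed
  have p_add: "p (x + y) = p x + p y" if "0 \<le> x" "0 \<le> y" for x y
  proof (rule antisym)
    have sum: "((\<lambda>t::real. inf x (t *\<^sub>R e) + inf y (t *\<^sub>R e)) \<longlongrightarrow> p x + p y) at_top"
      by (intro tendsto_add p)
    \<comment> \<open>By distributivity the right side is the infimum of the four sums
      \<open>x + y\<close>, \<open>t e + y\<close>, \<open>x + t e\<close> and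
      \<open>t e + t e\<close>, and the left side lies below each.\<close>
    have *: "inf (x + y) (t *\<^sub>R e) \<le> inf x (t *\<^sub>R e) + inf y (t *\<^sub>R e)" if "0 \<le> t" for t
    proof -
      have "inf (x + y) (t *\<^sub>R e) \<le> t *\<^sub>R e + y" "inf (x + y) (t *\<^sub>R e) \<le> x + t *\<^sub>R e"
        "inf (x + y) (t *\<^sub>R e) \<le> t *\<^sub>R e + t *\<^sub>R e"
        using \<open>0 \<le> x\<close> \<open>0 \<le> y\<close> te[OF that] by (auto intro!: le_infI2)
      then show ?thesis
        by (simp add: add_inf_distrib_left add_inf_distrib_right)
    qed
    show "p (x + y) \<le> p x + p y"
      by (rule tendsto_le_lattice[OF p sum], simp,
          rule eventually_mono[OF eventually_ge_at_top[of 0]]) (rule *)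
    have "inf x (t *\<^sub>R e) + inf y (t *\<^sub>R e) \<le> p (x + y)" for t
    proof -
      have "inf x (t *\<^sub>R e) + inf y (t *\<^sub>R e) \<le> inf (x + y) ((t + t) *\<^sub>R e)"
        unfolding scaleR_add_left by (intro le_infI add_mono inf_le1 inf_le2)
      also have "\<dots> \<le> p (x + y)"
        by (rule p_ge)
      finally show ?thesis .
    qed
    then show "p x + p y \<le> p (x + y)"
      by (intro tendsto_le_lattice[OF sum tendsto_const]) auto
  qed
  have p_scale: "p (c *\<^sub>R x) = c *\<^sub>R p x" if "0 < c" for c x
  proof (rule antisym)
    \<comment> \<open>Stated for all positive \<open>c\<close>, so that \<open>inverse c\<close>
      yields the reverse inequality.\<close>
    have le: "c *\<^sub>R p x \<le> p (c *\<^sub>R x)" if "0 < c" for c x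
    proof (rule tendsto_le_lattice[OF tendsto_scaleR[OF tendsto_const p] tendsto_const])
      have "c *\<^sub>R inf x (t *\<^sub>R e) \<le> p (c *\<^sub>R x)" for t
        using p_ge[of "c *\<^sub>R x" "c * t"] that by (simp add: scaleR_inf_distrib)
      then show "\<forall>\<^sub>F t in at_top. c *\<^sub>R inf x (t *\<^sub>R e) \<le> p (c *\<^sub>R x)"
        by simp
    qed simp
    then show "c *\<^sub>R p x \<le> p (c *\<^sub>R x)"
      using that .
    have "inverse c *\<^sub>R p (c *\<^sub>R x) \<le> p x"
      using le[of "inverse c" "c *\<^sub>R x"] that by simp
    from scaleR_left_mono[OF this, of c] that show "p (c *\<^sub>R x) \<le> c *\<^sub>R p x"
      by simp
  qed
  obtain P where P: "linear P" "\<And>x. 0 \<le> x \<Longrightarrow> P x = p x"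
    using linear_extension_from_cone[of p] p_add p_scale by blast
  have "P (P x) = P x" for x
  proof (rule linear_eq_on_cone[of "\<lambda>x. P (P x)" P])
    show "linear (\<lambda>x. P (P x))"
      using linear_compose[OF P(1) P(1)] by (simp add: o_def)
  qed (use P p_nonneg p_idem in auto)
  then have "band_projection P"
    unfolding band_projection_def using P p_nonneg p_le by auto
  moreover have "P e = e"
    using P(2)[OF assms] p_e by simp
  moreover have "P x = 0" if "0 \<le> x" "inf x e = 0" for x
  proof -
    have "inf x (t *\<^sub>R e) = 0" if "1 \<le> t" for t
    proof (rule antisym)
      have "1 *\<^sub>R x \<le> t *\<^sub>R x"
        using that \<open>0 \<le> x\<close> by (rule scaleR_right_mono)
      then have "inf x (t *\<^sub>R e) \<le> inf (t *\<^sub>R x) (t *\<^sub>R e)"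
        by (intro inf_mono) simp_all
      also have "\<dots> = 0"
        using that \<open>inf x e = 0\<close> by (simp flip: scaleR_inf_distrib)
      finally show "inf x (t *\<^sub>R e) \<le> 0" .
    qed (use \<open>0 \<le> x\<close> te[of t] that in auto)
    then have "((\<lambda>t::real. inf x (t *\<^sub>R e)) \<longlongrightarrow> 0) at_top"
      by (intro tendsto_eventually eventually_mono[OF eventually_ge_at_top[of 1]])
    then show ?thesis
      using p_eqI P(2)[OF \<open>0 \<le> x\<close>] by simp
  qed
  moreover have "Q (P x) = 0" if Q: "band_projection Q" "Q e = 0" for Q x
  proof (rule linear_eq_on_cone[of "\<lambda>x. Q (P x)" "\<lambda>x. 0"])
    show "linear (\<lambda>x. Q (P x))"
      using linear_compose[OF P(1) band_projection_linear[OF Q(1)]] by (simp add: o_def)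
    show "linear (\<lambda>x::'a. 0::'a)"
      by (simp add: linear_iff)
    fix x :: 'a assume "0 \<le> x"
    have "Q (inf x (t *\<^sub>R e)) \<le> 0" for t
      using band_projection_mono[OF Q(1), of "inf x (t *\<^sub>R e)" "t *\<^sub>R e"] Q
      by (simp add: band_projection_scale)
    then have "Q (p x) \<le> 0"
      using tendsto_le_lattice[OF bounded_linear.tendsto[OF band_projection_bounded_linear[OF Q(1)] p]
          tendsto_const[of 0]] by simp
    moreover have "0 \<le> Q (p x)"
      using Q(1) p_nonneg[OF \<open>0 \<le> x\<close>] by (rule band_projection_nonneg)
    ultimately show "Q (P x) = 0"
      using P(2)[OF \<open>0 \<le> x\<close>] by simp
  qed
  ultimately show ?thesis
    using that by blast
qed

section \<open>Almost band preserving maps\<close>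

locale almost_band_preserving =
  fixes T :: "'a::order_continuous_banach_lattice \<Rightarrow> 'a" and \<epsilon> :: real
  assumes linear_T: "linear T" and \<epsilon>_nonneg: "0 \<le> \<epsilon>"
    and band_preserving: "band_preserving_upto \<epsilon> T"
begin

section \<open>Diagonal and off-diagonal blocks of \<open>T\<close>\<close>

definition diag_bound :: "('a \<Rightarrow> 'a) \<Rightarrow> real \<Rightarrow> bool" where
  "diag_bound P M \<longleftrightarrow> 0 \<le> M \<and> (\<forall>x. norm (P (T (P x))) \<le> M * norm x)"

definition good :: "('a \<Rightarrow> 'a) \<Rightarrow> bool" where
  "good P \<longleftrightarrow> band_projection P \<and> (\<exists>M. diag_bound P M)"

text \<open>Test the band preserving condition at \<open>Q x\<close>, where
  \<open>Q = 1 - P\<close>, with \<open>y = P \<bar>T (Q x)\<bar>\<close>: this \<open>y\<close> is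
  disjoint from \<open>Q x\<close> and lies below \<open>\<bar>T (Q x)\<bar>\<close>, so the infimum
  is \<open>y\<close> itself.\<close>

lemma norm_off_diagonal_le:
  assumes P: "band_projection P"
  shows "norm (P (T (x - P x))) \<le> \<epsilon> * norm x"
proof -
  define Q where "Q x = x - P x" for x
  have Q: "band_projection Q"
    using band_projection_compl[OF P] by (simp add: Q_def[abs_def])
  define z where "z = T (Q x)"
  have nonneg: "0 \<le> P \<bar>z\<bar>" and le: "P \<bar>z\<bar> \<le> \<bar>z\<bar>"
    using band_projection_nonneg[OF P] band_projection_le[OF P] by simp_all
  have "inf \<bar>P \<bar>z\<bar>\<bar> \<bar>Q x\<bar> = 0"
    using band_projection_disjoint_compl[OF Q abs_ge_zero, of z x] P
    by (simp add: Q_def band_projection_diff band_projection_idem)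
  then have "norm (inf \<bar>T (Q x)\<bar> (P \<bar>z\<bar>)) \<le> \<epsilon> * norm (Q x)"
    using band_preserving nonneg by (simp add: band_preserving_upto_iff disjoint_elems_def)
  then have "norm (P \<bar>z\<bar>) \<le> \<epsilon> * norm (Q x)"
    using le by (simp add: z_def[symmetric] inf_absorb2)
  moreover have "norm (P z) \<le> norm (P \<bar>z\<bar>)"
    using band_projection_abs_le[OF P, of z] nonneg by (intro norm_mono_abs) simp
  moreover have "\<epsilon> * norm (Q x) \<le> \<epsilon> * norm x"
    using band_projection_norm_le[OF Q] \<epsilon>_nonneg by (rule mult_left_mono)
  ultimately show ?thesis
    by (simp add: z_def Q_def)
qed

lemma norm_disjoint_le:
  assumes P: "band_projection P" and Q: "band_projection Q" and "\<And>x. P (Q x) = 0"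
  shows "norm (P (T (Q x))) \<le> \<epsilon> * norm x"
proof -
  have "norm (P (T (Q x))) \<le> \<epsilon> * norm (Q x)"
    using norm_off_diagonal_le[OF P, of "Q x"] assms(3) by simp
  also have "\<dots> \<le> \<epsilon> * norm x"
    using band_projection_norm_le[OF Q] \<epsilon>_nonneg by (rule mult_left_mono)
  finally show ?thesis .
qed

text \<open>
  Gliding hump: if every \<open>P n\<close> violated its bound at some unit vector \<open>x n\<close>, then for
  \<open>x = (\<Sum>n. 2\<^sup>-\<^sup>n P n (x n))\<close> the components \<open>P n (T x)\<close> would be unbounded, as the off-diagonal
  contributions are at most \<open>\<epsilon> * norm x\<close>.
\<close>

lemma disjoint_sequence_diag_bound:
  fixes P :: "nat \<Rightarrow> 'a \<Rightarrow> 'a"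
  assumes P: "\<And>n. band_projection (P n)"
    and disjoint: "\<And>m n x. m \<noteq> n \<Longrightarrow> P m (P n x) = 0"
  shows "\<exists>n. diag_bound (P n) (real n * 2 ^ n)"
proof (rule ccontr)
  assume "\<not> ?thesis"
  then have "\<forall>n. \<exists>x. real n * 2 ^ n * norm x < norm (P n (T (P n x)))"
    by (auto simp: diag_bound_def not_le)
  then obtain y where y: "\<And>n. real n * 2 ^ n * norm (y n) < norm (P n (T (P n (y n))))"
    by metis
  have y0: "y n \<noteq> 0" for n
    using y[of n] linear_0[OF linear_T] band_projection_zero[OF P] by fastforce
  \<comment> \<open>The weight makes the series summable and cancels the factor \<open>2 ^ n\<close>
    of the violated bound, so that \<open>P n (T (z n))\<close> still has norm above
    \<open>n\<close>.\<close>
  define z where "z n = ((1/2) ^ n / norm (y n)) *\<^sub>R P n (y n)" for n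
  have z_norm: "norm (z n) \<le> (1/2) ^ n" for n
    using band_projection_norm_le[OF P, of n "y n"] y0[of n]
    by (simp add: z_def divide_simps)
  have Pz: "P n (z n) = z n" "m \<noteq> n \<Longrightarrow> P m (z n) = 0" for m n
    by (simp_all add: z_def band_projection_scale[OF P] band_projection_idem[OF P] disjoint)
  have Tz: "real n < norm (P n (T (z n)))" for n
  proof -
    have "norm (P n (T (z n))) = (1/2) ^ n / norm (y n) * norm (P n (T (P n (y n))))"
      by (simp add: z_def linear_scale[OF linear_T] band_projection_scale[OF P])
    moreover have "(1/2) ^ n / norm (y n) * (real n * 2 ^ n * norm (y n)) = real n"
      using y0[of n] by (simp add: field_simps)
    moreover have "(1/2) ^ n / norm (y n) * (real n * 2 ^ n * norm (y n))
        < (1/2) ^ n / norm (y n) * norm (P n (T (P n (y n))))"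
      by (rule mult_strict_left_mono[OF y]) (simp add: y0)
    ultimately show ?thesis by simp
  qed
  have "summable z"
    by (rule summable_comparison_test'[of "\<lambda>n. (1/2) ^ n"]) (auto simp: z_norm)
  define x where "x = (\<Sum>n. z n)"
  have Px: "P n x = z n" for n
  proof -
    have "P n x = (\<Sum>m. P n (z m))"
      unfolding x_def
      by (rule bounded_linear.suminf[OF band_projection_bounded_linear[OF P] \<open>summable z\<close>])
    also have "\<dots> = (\<Sum>m\<in>{n}. P n (z m))"
      by (rule suminf_finite) (auto simp: Pz)
    finally show ?thesis
      by (simp add: Pz)
  qed
  have "real n < norm (T x) + \<epsilon> * norm x" for n
  proof -
    have "P n (T (z n)) = P n (T x) - P n (T (x - P n x))"
      by (simp add: Px linear_diff[OF linear_T] band_projection_diff[OF P])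
    then have "norm (P n (T (z n))) \<le> norm (P n (T x)) + norm (P n (T (x - P n x)))"
      by (metis norm_triangle_ineq4)
    then show ?thesis
      using Tz[of n] band_projection_norm_le[OF P, of n "T x"] norm_off_diagonal_le[OF P, of n x]
      by linarith
  qed
  moreover obtain n :: nat where "norm (T x) + \<epsilon> * norm x < real n"
    using reals_Archimedean2 by blast
  ultimately show False
    by (meson less_asym)
qed

text \<open>Commuting the inner factors turns the block into \<open>P (Q T Q) P\<close>, and
  \<open>P\<close> is a contraction.\<close>

lemma diag_bound_compose:
  assumes P: "band_projection P" and Q: "band_projection Q" and "diag_bound Q M"
  shows "diag_bound (\<lambda>x. P (Q x)) M"
  unfolding diag_bound_def
proof (intro conjI allI)
  show "0 \<le> M"
    using assms by (simp add: diag_bound_def)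
  fix x
  have "norm (P (Q (T (P (Q x))))) \<le> norm (Q (T (Q (P x))))"
    using band_projection_norm_le[OF P, of "Q (T (Q (P x)))"]
    by (simp only: band_projection_commute[OF P Q, of x])
  also have "\<dots> \<le> M * norm (P x)"
    using assms by (simp add: diag_bound_def)
  also have "\<dots> \<le> M * norm x"
    using band_projection_norm_le[OF P] \<open>0 \<le> M\<close> by (rule mult_left_mono)
  finally show "norm (P (Q (T (P (Q x))))) \<le> M * norm x" .
qed

text \<open>The block splits into two diagonal and two off-diagonal ones; each of the latter
  contributes \<open>\<epsilon>\<close>.\<close>

lemma diag_bound_add:
  assumes P: "band_projection P" "diag_bound P M" and Q: "band_projection Q" "diag_bound Q N"
    and disjoint: "\<And>x. P (Q x) = 0"
  shows "diag_bound (\<lambda>x. P x + Q x) (M + N + 2 * \<epsilon>)"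
  unfolding diag_bound_def
proof (intro conjI allI)
  show "0 \<le> M + N + 2 * \<epsilon>"
    using assms \<epsilon>_nonneg by (simp add: diag_bound_def)
  fix x
  have disjoint': "Q (P x) = 0" for x
    using disjoint band_projection_commute[OF P(1) Q(1)] by metis
  have "P (T (P x + Q x)) + Q (T (P x + Q x))
      = (P (T (P x)) + Q (T (Q x))) + (P (T (Q x)) + Q (T (P x)))"
    using P Q by (simp add: linear_add[OF linear_T] band_projection_add)
  then have "norm (P (T (P x + Q x)) + Q (T (P x + Q x)))
      \<le> (norm (P (T (P x))) + norm (Q (T (Q x)))) + (norm (P (T (Q x))) + norm (Q (T (P x))))"
    by (simp only:) (intro norm_triangle_le add_mono norm_triangle_ineq)
  also have "\<dots> \<le> (M * norm x + N * norm x) + (\<epsilon> * norm x + \<epsilon> * norm x)"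
    using P Q norm_disjoint_le[OF P(1) Q(1) disjoint] norm_disjoint_le[OF Q(1) P(1) disjoint']
    by (intro add_mono) (auto simp: diag_bound_def)
  finally show "norm (P (T (P x + Q x)) + Q (T (P x + Q x))) \<le> (M + N + 2 * \<epsilon>) * norm x"
    by (simp add: algebra_simps)
qed

section \<open>Good projections and the uniform bound on their diagonal blocks\<close>

lemma good_zero: "good (\<lambda>x. 0)"
  by (auto simp: good_def band_projection_zero_fun diag_bound_def intro!: exI[of _ 0])

lemma good_diff:
  assumes "band_projection P" "good Q"
  shows "good (\<lambda>x. Q x - P (Q x))"
  using assms band_projection_compose[OF band_projection_compl[of P], of Q]
    diag_bound_compose[OF band_projection_compl[of P], of Q]
  by (auto simp: good_def)

text \<open>The join is the sum of \<open>P\<close> and the good projection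
  \<open>(1 - P) Q\<close>, which are disjoint.\<close>

lemma good_join:
  assumes P: "good P" and Q: "good Q"
  shows "good (\<lambda>x. P x + (Q x - P (Q x)))"
proof -
  have bp: "band_projection P" "band_projection Q"
    using assms by (auto simp: good_def)
  obtain M N where M: "diag_bound P M" and N: "diag_bound (\<lambda>x. Q x - P (Q x)) N"
    using P good_diff[OF bp(1) Q] by (auto simp: good_def)
  have "diag_bound (\<lambda>x. P x + (Q x - P (Q x))) (M + N + 2 * \<epsilon>)"
    using good_diff[OF bp(1) Q] bp
    by (intro diag_bound_add M N) (auto simp: good_def band_projection_diff band_projection_idem)
  then show ?thesis
    using band_projection_join[OF bp] by (auto simp: good_def)
qed

text \<open>Without a uniform bound, a new piece with arbitrarily large diagonal block can always be
  found off a given good \<open>H\<close>. Joining the pieces to \<open>H\<close> one by one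
  produces a disjoint sequence that contradicts the gliding hump lemma.\<close>

lemma good_uniform_bound: "\<exists>M. \<forall>P. good P \<longrightarrow> diag_bound P M"
proof (rule ccontr)
  assume "\<not> ?thesis"
  then have unbounded: "\<exists>P. good P \<and> \<not> diag_bound P M" for M
    by blast
  have step: "\<exists>D. good D \<and> (\<forall>x. D (H x) = 0) \<and> \<not> diag_bound D c" if H: "good H" for H c
  proof -
    obtain b where b: "diag_bound H b" and bpH: "band_projection H"
      using H by (auto simp: good_def)
    \<comment> \<open>\<open>G\<close> splits into \<open>G H\<close>, with bound \<open>b\<close>,
      and \<open>D\<close>. The constant is what \<open>diag_bound_add\<close> would give if
      \<open>D\<close> had bound \<open>c\<close>.\<close>
    obtain G where G: "good G" and nG: "\<not> diag_bound G (b + c + 2 * \<epsilon>)"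
      using unbounded by blast
    then have bpG: "band_projection G"
      by (simp add: good_def)
    note comm = band_projection_commute[OF bpG bpH]
    define D where "D x = G x - H (G x)" for x
    have D: "good D"
      using good_diff[OF bpH G] by (simp add: D_def[abs_def])
    have "\<not> diag_bound D c"
    proof
      assume c: "diag_bound D c"
      have "diag_bound (\<lambda>x. G (H x) + D x) (b + c + 2 * \<epsilon>)"
      proof (rule diag_bound_add[OF _ _ _ c])
        show "band_projection (\<lambda>x. G (H x))" "diag_bound (\<lambda>x. G (H x)) b"
          using band_projection_compose[OF bpG bpH] diag_bound_compose[OF bpG bpH b] .
        show "G (H (D x)) = 0" for x
          using bpG bpH
          by (simp add: D_def band_projection_diff band_projection_idem band_projection_zero)
      qed (use D in \<open>simp add: good_def\<close>)
      moreover have "(\<lambda>x. G (H x) + D x) = G"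
        by (simp add: D_def fun_eq_iff comm)
      ultimately show False
        using nG by simp
    qed
    moreover have "D (H x) = 0" for x
      by (simp add: D_def comm band_projection_idem[OF bpH])
    ultimately show ?thesis
      using D by blast
  qed
  \<comment> \<open>A state pairs the join of all earlier pieces with the next piece, which is
    disjoint from it and violates the bound of the gliding hump lemma.\<close>
  define R where "R n S \<longleftrightarrow> good (fst S) \<and> good (snd S) \<and> (\<forall>x. snd S (fst S x) = 0)
      \<and> \<not> diag_bound (snd S) (real n * 2 ^ n)" for n and S :: "('a \<Rightarrow> 'a) \<times> ('a \<Rightarrow> 'a)"
  have "\<exists>f. \<forall>n. R n (f n) \<and> fst (f (Suc n)) = (\<lambda>x. fst (f n) x + snd (f n) x)"
  proof (rule dependent_nat_choice)
    show "\<exists>S. R 0 S"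
      using step[OF good_zero] good_zero by (auto simp: R_def)
    fix S n assume S: "R n S"
    let ?H = "\<lambda>x. fst S x + snd S x"
    have "fst S (snd S x) = 0" for x
      using S band_projection_commute[of "fst S" "snd S" x] by (simp add: R_def good_def)
    then have H: "good ?H"
      using good_join[of "fst S" "snd S"] S by (simp add: R_def)
    then obtain D where "good D" "\<forall>x. D (?H x) = 0" "\<not> diag_bound D (real (Suc n) * 2 ^ Suc n)"
      using step by blast
    with H have "R (Suc n) (?H, D)"
      unfolding R_def fst_conv snd_conv by blast
    then show "\<exists>S'. R (Suc n) S' \<and> fst S' = ?H"
      by (intro exI[of _ "(?H, D)"]) simp
  qed
  then obtain f where R: "\<And>n. R n (f n)"
    and Suc: "\<And>n. fst (f (Suc n)) = (\<lambda>x. fst (f n) x + snd (f n) x)"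
    by blast
  define H where "H n = fst (f n)" for n
  define D where "D n = snd (f n)" for n
  have bp: "band_projection (H n)" "band_projection (D n)" and DH: "D n (H n x) = 0"
    and nD: "\<not> diag_bound (D n) (real n * 2 ^ n)" and HS: "H (Suc n) x = H n x + D n x" for n x
    using R[of n] Suc[of n] by (auto simp: R_def H_def D_def good_def)
  \<comment> \<open>Piece \<open>n\<close> is absorbed into the join from index \<open>n + 1\<close>
    on, so every later piece annihilates it.\<close>
  have HD: "H m (D n x) = D n x" if "Suc n \<le> m" for m n x
    using that
  proof (induction m rule: dec_induct)
    case base
    show ?case
      using DH[of n x] bp
      by (simp add: HS band_projection_idem band_projection_commute[of "H n" "D n"])
  next
    case (step m)
    then show ?case
      using DH[of m "D n x"] by (simp add: HS)
  qed
  have less: "D m (D n x) = 0" if "n < m" for m n x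
    using DH[of m "D n x"] HD[of n m x] that by simp
  have "D m (D n x) = 0" if "m \<noteq> n" for m n x
    using less[of n m x] less[of m n x] that band_projection_commute[OF bp(2) bp(2), of m n x]
    by (cases "n < m") auto
  then show False
    using disjoint_sequence_diag_bound[of D] bp nD by blast
qed

section \<open>Atoms, splitting, and exhaustion by good projections\<close>

text \<open>
  If \<open>w\<close> does not split, then \<open>P x\<close> is comparable to every multiple of \<open>w\<close>, so the band of \<open>w\<close> is
  one-dimensional.
\<close>

lemma good_atom:
  assumes w: "0 \<le> w" "w \<noteq> 0"
    and P: "band_projection P" "P w = w" "\<And>x. 0 \<le> x \<Longrightarrow> inf x w = 0 \<Longrightarrow> P x = 0"
    and atom: "\<And>a b. 0 \<le> a \<Longrightarrow> a \<le> w \<Longrightarrow> 0 \<le> b \<Longrightarrow> b \<le> w \<Longrightarrow> inf a b = 0 \<Longrightarrow> a = 0 \<or> b = 0"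
  shows "good P"
proof -
  have pos: "\<exists>c. P x = c *\<^sub>R w" if "0 \<le> x" for x
  proof -
    define u where "u = P x"
    have "0 \<le> u"
      unfolding u_def using P(1) that by (rule band_projection_nonneg)
    have comparable: "c *\<^sub>R w \<le> u \<or> u \<le> c *\<^sub>R w" for c
    proof -
      define v where "v = c *\<^sub>R w - u"
      have v: "P v = v"
        using P by (simp add: v_def u_def band_projection_diff band_projection_scale band_projection_idem)
      have neg: "P (- v) = - v"
        using v P by (simp add: band_projection_neg)
      \<comment> \<open>The two parts of \<open>v\<close> cut off at \<open>w\<close> are disjoint
        pieces of \<open>w\<close>, so one is \<open>0\<close>. The corresponding part of
        \<open>v\<close> is then killed by \<open>P\<close>, yet also fixed by it, hence it
        vanishes.\<close>
      have "inf (inf (pprt v) w) (inf (pprt (- v)) w) \<le> inf (pprt v) (pprt (- v))"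
        by (intro inf_mono inf_le1)
      then have "inf (inf (pprt v) w) (inf (pprt (- v)) w) = 0"
        using w by (intro antisym) (simp_all add: inf_pprt_pprt_neg del: inf_le1 inf_le2)
      then have "inf (pprt v) w = 0 \<or> inf (pprt (- v)) w = 0"
        using w by (intro atom) auto
      then have "pprt v = 0 \<or> pprt (- v) = 0"
        using P(3)[of "pprt v"] P(3)[of "pprt (- v)"]
          band_projection_pprt_fixed[OF P(1) v] band_projection_pprt_fixed[OF P(1) neg]
        by auto
      then have "v \<le> 0 \<or> - v \<le> 0"
        by (simp only: le_zero_iff_zero_pprt)
      then show ?thesis
        by (simp add: v_def)
    qed
    define A where "A = {c::real. c *\<^sub>R w \<le> u}"
    have "c \<le> norm u / norm w" if "c \<in> A" for c
    proof (cases "0 \<le> c")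
      case True
      then have "norm (c *\<^sub>R w) \<le> norm u"
        using that w by (intro norm_mono_nonneg) (auto simp: A_def scaleR_nonneg_nonneg)
      then show ?thesis
        using True w by (simp add: field_simps)
    next
      case False
      then show ?thesis
        by (meson divide_nonneg_nonneg linear norm_ge_zero order_trans)
    qed
    then have bdd: "bdd_above A"
      by (rule bdd_aboveI)
    have "A \<noteq> {}"
      using \<open>0 \<le> u\<close> by (auto simp: A_def intro!: exI[of _ 0])
    \<comment> \<open>The supremum is the coefficient of \<open>u\<close>: slightly smaller
      multiples of \<open>w\<close> lie below \<open>u\<close>, and slightly larger ones lie above
      it by comparability.\<close>
    define c where "c = Sup A"
    have "norm (u - c *\<^sub>R w) \<le> 0"
    proof (rule field_le_epsilon)
      fix e :: real assume "0 < e"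
      define \<delta> where "\<delta> = e / norm w"
      have "0 < \<delta>"
        using \<open>0 < e\<close> w by (simp add: \<delta>_def)
      obtain c' where c': "c' \<in> A" "c - \<delta> < c'"
        using less_cSupD[OF \<open>A \<noteq> {}\<close>, of "c - \<delta>"] \<open>0 < \<delta>\<close> by (auto simp: c_def)
      have "(c - \<delta>) *\<^sub>R w \<le> c' *\<^sub>R w"
        using c' w by (intro scaleR_right_mono) auto
      then have lower: "(c - \<delta>) *\<^sub>R w \<le> u"
        using c' by (simp add: A_def)
      have "c + \<delta> \<notin> A"
        using cSup_upper[OF _ bdd, of "c + \<delta>"] \<open>0 < \<delta>\<close> by (auto simp: c_def)
      then have upper: "u \<le> (c + \<delta>) *\<^sub>R w"
        using comparable by (auto simp: A_def)
      have "\<bar>u - c *\<^sub>R w\<bar> \<le> \<delta> *\<^sub>R w"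
        using lower upper by (simp add: abs_le_iff scaleR_add_left scaleR_diff_left algebra_simps)
      also have "\<dots> \<le> \<bar>\<delta> *\<^sub>R w\<bar>"
        by (rule abs_ge_self)
      finally have "norm (u - c *\<^sub>R w) \<le> norm (\<delta> *\<^sub>R w)"
        by (rule norm_mono_abs)
      then show "norm (u - c *\<^sub>R w) \<le> 0 + e"
        using \<open>0 < e\<close> w by (simp add: \<delta>_def)
    qed
    then show ?thesis
      by (auto simp: u_def)
  qed
  have multiple: "\<exists>c. P x = c *\<^sub>R w" for x
  proof -
    obtain c d where "P (pprt x) = c *\<^sub>R w" "P (pprt (- x)) = d *\<^sub>R w"
      using pos[OF zero_le_pprt] by metis
    then have "P (pprt x - pprt (- x)) = (c - d) *\<^sub>R w"
      using P(1) by (simp add: band_projection_diff scaleR_diff_left)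
    then show ?thesis
      by (auto simp: pprt_diff_pprt_neg)
  qed
  \<comment> \<open>With \<open>P x = c w\<close>, the block is \<open>c P (T w)\<close>, and
    contractivity of \<open>P\<close> gives
    \<open>\<bar>c\<bar> * norm w \<le> norm x\<close>.\<close>
  have "norm (P (T (P x))) \<le> norm (T w) / norm w * norm x" for x
  proof -
    obtain c where c: "P x = c *\<^sub>R w"
      using multiple by blast
    have "\<bar>c\<bar> * norm w \<le> norm x"
      using band_projection_norm_le[OF P(1), of x] by (simp add: c)
    then have "\<bar>c\<bar> * norm (T w) \<le> norm x / norm w * norm (T w)"
      using w by (intro mult_right_mono) (auto simp: field_simps)
    moreover have "norm (P (T (P x))) \<le> \<bar>c\<bar> * norm (T w)"
      using band_projection_norm_le[OF P(1), of "T (P x)"]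
      by (simp add: c linear_scale[OF linear_T])
    ultimately show ?thesis
      by (simp add: field_simps)
  qed
  then have "diag_bound P (norm (T w) / norm w)"
    by (simp add: diag_bound_def)
  then show ?thesis
    using P(1) by (auto simp: good_def)
qed

text \<open>If \<open>w\<close> did not split, its principal projection would be good by
  \<open>good_atom\<close>, yet it fixes \<open>w\<close>.\<close>

lemma annihilated_splits:
  assumes w: "0 \<le> w" "w \<noteq> 0" and ann: "\<And>P. good P \<Longrightarrow> P w = 0"
  shows "\<exists>a b. 0 \<le> a \<and> a \<le> w \<and> a \<noteq> 0 \<and> 0 \<le> b \<and> b \<le> w \<and> b \<noteq> 0 \<and> inf a b = 0"
proof (rule ccontr)
  assume contra: "\<not> ?thesis"
  obtain P where "band_projection P" "P w = w" "\<And>x. 0 \<le> x \<Longrightarrow> inf x w = 0 \<Longrightarrow> P x = 0"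
    using principal_band_projection[OF w(1)] by metis
  moreover from this have "good P"
    using contra by (intro good_atom[OF w]) blast+
  ultimately show False
    using ann w by force
qed

text \<open>Splitting repeatedly, keeping one piece and splitting the other, gives disjoint nonzero
  pieces \<open>e n\<close> of \<open>w\<close>. By the gliding hump lemma one of their principal
  projections is good, although it fixes its piece instead of killing it.\<close>

lemma good_total:
  assumes w: "0 \<le> w" and ann: "\<And>P. good P \<Longrightarrow> P w = 0"
  shows "w = 0"
proof (rule ccontr)
  assume "w \<noteq> 0"
  define R where "R S \<longleftrightarrow> 0 \<le> fst S \<and> fst S \<le> w \<and> fst S \<noteq> 0 \<and> 0 \<le> snd S \<and> snd S \<le> w
      \<and> snd S \<noteq> 0 \<and> inf (fst S) (snd S) = 0" for S
  \<comment> \<open>Annihilation passes to all positive elements below \<open>w\<close>, so every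
    piece can be split again.\<close>
  have ann': "P x = 0" if "good P" "0 \<le> x" "x \<le> w" for P x
    using band_projection_nonneg[of P x] band_projection_mono[of P x w] ann[OF that(1)] that
    by (simp add: good_def)
  have split: "\<exists>S. R S \<and> fst S \<le> x \<and> snd S \<le> x" if x: "0 \<le> x" "x \<le> w" "x \<noteq> 0" for x
  proof -
    obtain a b where "0 \<le> a" "a \<le> x" "a \<noteq> 0" "0 \<le> b" "b \<le> x" "b \<noteq> 0" "inf a b = 0"
      using annihilated_splits[OF x(1,3)] ann' x by blast
    then show ?thesis
      using x by (intro exI[of _ "(a, b)"]) (auto simp: R_def)
  qed
  have "\<exists>f. \<forall>n::nat. R (f n) \<and> (fst (f (Suc n)) \<le> snd (f n) \<and> snd (f (Suc n)) \<le> snd (f n))"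
  proof (rule dependent_nat_choice)
    show "\<exists>S. R S"
      using split[OF w order_refl \<open>w \<noteq> 0\<close>] by blast
    show "\<exists>S'. R S' \<and> fst S' \<le> snd S \<and> snd S' \<le> snd S" if "R S" for S
      using split[of "snd S"] that by (auto simp: R_def)
  qed
  then obtain f where R: "\<And>n::nat. R (f n)"
    and dec: "\<And>n. fst (f (Suc n)) \<le> snd (f n)" "\<And>n. snd (f (Suc n)) \<le> snd (f n)"
    by blast
  define e where "e n = fst (f n)" for n
  have e: "0 \<le> e n" "e n \<le> w" "e n \<noteq> 0" for n
    using R[of n] by (auto simp: R_def e_def)
  have less: "inf (e n) (e m) = 0" if "n < m" for m n
  proof -
    obtain k where k: "m = Suc k" "n \<le> k"
      using \<open>n < m\<close> by (cases m) auto
    have "e m \<le> snd (f k)"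
      using dec(1)[of k] k by (simp add: e_def)
    also have "\<dots> \<le> snd (f n)"
      using lift_Suc_antimono_le[of "\<lambda>n. snd (f n)" n k] dec(2) k by blast
    finally have "inf (e n) (e m) \<le> inf (e n) (snd (f n))"
      by (intro inf_mono order_refl)
    also have "\<dots> = 0"
      using R[of n] by (simp add: R_def e_def)
    finally show ?thesis
      using e by (intro antisym) auto
  qed
  have disj: "inf (e m) (e n) = 0" if "m \<noteq> n" for m n
    using less[of n m] less[of m n] that by (cases "n < m") (auto simp: inf_commute)
  have "\<exists>P. band_projection P \<and> P (e n) = e n
      \<and> (\<forall>x. 0 \<le> x \<longrightarrow> inf x (e n) = 0 \<longrightarrow> P x = 0)
      \<and> (\<forall>Q x. band_projection Q \<longrightarrow> Q (e n) = 0 \<longrightarrow> Q (P x) = 0)" for n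
    using principal_band_projection[OF e(1)[of n]] by metis
  then obtain P where P: "\<And>n. band_projection (P n)" "\<And>n. P n (e n) = e n"
    "\<And>n x. 0 \<le> x \<Longrightarrow> inf x (e n) = 0 \<Longrightarrow> P n x = 0"
    "\<And>n Q x. band_projection Q \<Longrightarrow> Q (e n) = 0 \<Longrightarrow> Q (P n x) = 0"
    by metis
  \<comment> \<open>\<open>P m\<close> kills \<open>e n\<close> by disjointness, and therefore
    everything in the range of \<open>P n\<close>.\<close>
  have "P m (P n x) = 0" if "m \<noteq> n" for m n x
    using P(4)[OF P(1)] P(3)[OF e(1)] disj that by metis
  then obtain n where "diag_bound (P n) (real n * 2 ^ n)"
    using disjoint_sequence_diag_bound[of P] P(1) by blast
  then have "good (P n)"
    using P(1) by (auto simp: good_def)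
  then have "P n (e n) = 0"
    using e by (intro ann')
  then show False
    using P(2) e(3) by simp
qed

text \<open>The values \<open>P u\<close> are directed upwards through joins, so they approach their
  supremum \<open>s\<close> in norm. The remainder \<open>u - s\<close> is annihilated by all good
  projections, hence \<open>0\<close> by \<open>good_total\<close>.\<close>

lemma good_approximates:
  assumes "0 \<le> u" "0 < \<delta>"
  shows "\<exists>P. good P \<and> norm (u - P u) < \<delta>"
proof -
  define D where "D = {P u |P. good P}"
  obtain s where s: "\<And>a. a \<in> D \<Longrightarrow> a \<le> s"
    "\<And>y. (\<And>a. a \<in> D \<Longrightarrow> a \<le> y) \<Longrightarrow> s \<le> y"
    "\<And>e. 0 < e \<Longrightarrow> \<exists>a\<in>D. \<forall>b\<in>D. a \<le> b \<longrightarrow> norm (s - b) < e"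
  proof (rule directed_bounded_norm_sup[of D u])
    show "D \<noteq> {}"
      using good_zero by (auto simp: D_def)
    show "a \<le> u" if "a \<in> D" for a
      using that band_projection_le[OF _ \<open>0 \<le> u\<close>] by (auto simp: D_def good_def)
    show "\<exists>c\<in>D. a \<le> c \<and> b \<le> c" if ab: "a \<in> D" "b \<in> D" for a b
    proof -
      obtain P Q where PQ: "a = P u" "b = Q u" "good P" "good Q"
        using ab by (auto simp: D_def)
      then have bp: "band_projection P" "band_projection Q"
        by (auto simp: good_def)
      have "P u + (Q u - P (Q u)) \<in> D"
        using good_join[OF PQ(3,4)] by (auto simp: D_def)
      moreover have "P (Q u) \<le> Q u"
        using bp(1) band_projection_nonneg[OF bp(2) \<open>0 \<le> u\<close>] by (rule band_projection_le)
      moreover have "P (Q u) \<le> P u"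
        using bp(1) band_projection_le[OF bp(2) \<open>0 \<le> u\<close>] by (rule band_projection_mono)
      ultimately show ?thesis
        using PQ by (intro bexI[of _ "P u + (Q u - P (Q u))"]) (auto simp: algebra_simps)
    qed
  qed blast
  have "u - s = 0"
  proof (rule good_total)
    show "0 \<le> u - s"
      using s(2)[of u] band_projection_le[OF _ \<open>0 \<le> u\<close>] by (auto simp: D_def good_def)
    fix P assume P: "good P"
    then have bp: "band_projection P"
      by (simp add: good_def)
    have "P u \<le> s"
      using P by (intro s(1)) (auto simp: D_def)
    \<comment> \<open>Apply \<open>P\<close> to \<open>P u \<le> s\<close> and use
      idempotence.\<close>
    then have "P (u - s) \<le> 0"
      using band_projection_mono[OF bp, of "P u" s] bp
      by (simp add: band_projection_diff band_projection_idem)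
    then show "P (u - s) = 0"
      using band_projection_nonneg[OF bp \<open>0 \<le> u - s\<close>] by simp
  qed
  then show ?thesis
    using s(3)[OF \<open>0 < \<delta>\<close>] by (auto simp: D_def)
qed

lemma bounded_linear_T: "bounded_linear T"
proof -
  obtain M where M: "\<And>P. good P \<Longrightarrow> diag_bound P M"
    using good_uniform_bound by blast
  have "norm (T x) \<le> norm x * (M + \<epsilon>)" for x
  proof (rule field_le_epsilon)
    fix \<delta> :: real assume "0 < \<delta>"
    \<comment> \<open>Approximation is available for positive elements only; the complement of
      \<open>P\<close> carries it from \<open>\<bar>T x\<bar>\<close> over to
      \<open>T x\<close>.\<close>
    define z where "z = \<bar>T x\<bar>"
    obtain P where P: "good P" and approx: "norm (z - P z) < \<delta>"
      using good_approximates[OF abs_ge_zero \<open>0 < \<delta>\<close>] unfolding z_def by blast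
    then have bp: "band_projection P"
      by (simp add: good_def)
    have "\<bar>T x - P (T x)\<bar> \<le> z - P z"
      unfolding z_def by (rule band_projection_abs_le[OF band_projection_compl[OF bp]])
    also have "\<dots> \<le> \<bar>z - P z\<bar>"
      by (rule abs_ge_self)
    finally have 1: "norm (T x - P (T x)) < \<delta>"
      using approx norm_mono_abs by (meson le_less_trans)
    have "P (T x) = P (T (P x)) + P (T (x - P x))"
      using bp by (simp add: linear_diff[OF linear_T] band_projection_diff)
    then have "norm (P (T x)) \<le> norm (P (T (P x))) + norm (P (T (x - P x)))"
      by (metis norm_triangle_ineq)
    also have "\<dots> \<le> M * norm x + \<epsilon> * norm x"
      using M[OF P] norm_off_diagonal_le[OF bp] by (intro add_mono) (auto simp: diag_bound_def)
    finally have 2: "norm (P (T x)) \<le> norm x * (M + \<epsilon>)"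
      by (simp add: algebra_simps)
    have "norm (T x) \<le> norm (P (T x)) + norm (T x - P (T x))"
      using norm_triangle_ineq[of "P (T x)" "T x - P (T x)"] by simp
    with 1 2 show "norm (T x) \<le> norm x * (M + \<epsilon>) + \<delta>"
      by linarith
  qed
  then show ?thesis
    using linear_T by (intro bounded_linear_intro[of T "M + \<epsilon>"]) (auto simp: linear_add linear_scale)
qed

end

theorem corollary3p6:
  fixes \<epsilon> :: real and T :: "'a::order_continuous_banach_lattice \<Rightarrow> 'a"
  assumes "\<epsilon> > 0"
    and "linear T"
    and "band_preserving_upto \<epsilon> T"
  shows "continuous_on UNIV T"
proof -
  interpret almost_band_preserving T \<epsilon>
    by (rule almost_band_preserving.intro) (use assms in auto)
  show ?thesis
    using bounded_linear_T by (rule linear_continuous_on)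
qed

end
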